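(* Let $X\sim N(\theta,\sigma^2)$ with $\sigma^2>0$ known, let the loss for estimating $\theta$ by $d\in\mathbb{R}$ be $(d-\theta)^2$, and let the parameter space be $\{\theta\in\mathbb{R}:\theta\ge 0\}$. For every $c\in(0,1]$, the estimator $$\delta_c(X)=X+c\,\sigma\,R\!\left(\frac{cX}{\sigma}\right)$$ dominates $\delta_0(X)=X$ on this parameter space, and is thus minimax for the parameter space $\theta\ge 0$.
   Context: $\phi$ and $\Phi$ denote the probability density function and cumulative distribution function of the $N(0,1)$ distribution, and $R(t)=\phi(t)/\Phi(t)$, $t\in\mathbb{R}$, is the inverse Mill's ratio. The risk of an estimator $\delta$ is $R(\theta,\delta)=E_\theta[(\delta(X)-\theta)^2]$. An estimator $\delta$ dominates $\delta'$ on the parameter space if $R(\theta,\delta)\le R(\theta,\delta')$ for all $\theta\ge 0$, with strict inequality for at least one $\theta\ge0$. An estimator $\delta$ is minimax for the parameter space $\theta\ge0$ if $\sup_{\theta\ge 0}R(\theta,\delta)=\inf_{\delta'}\sup_{\theta\ge0}R(\theta,\delta')$, the infimum being over all estimators $\delta'$. *)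

theory Defs
  imports "HOL-Probability.Probability"
begin

definition inverse_mills :: "real \<Rightarrow> real" where
  "inverse_mills t = std_normal_density t / cdf std_normal_distribution t"

text \<open>The second parameter is the standard deviation, not the variance
  (as in \<^const>\<open>normal_density\<close>).\<close>

definition normal_law :: "real \<Rightarrow> real \<Rightarrow> real measure" where
  "normal_law \<theta> \<sigma> = density lborel (normal_density \<theta> \<sigma>)"

text \<open>An estimator \<open>\<delta>(X)\<close> is identified with the Borel function \<open>\<delta>\<close> of the observation.\<close>

definition estimator :: "(real \<Rightarrow> real) \<Rightarrow> bool" where
  "estimator \<delta> \<longleftrightarrow> \<delta> \<in> borel_measurable borel"

text \<open>Squared error risk under \<open>X \<sim> N(\<theta>, \<sigma>\<^sup>2)\<close>. The expectation takes values in
  \<open>[0, \<infinity>]\<close>, so that the risk of an estimator without second moment is \<open>\<infinity>\<close>.\<close>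

definition risk :: "real \<Rightarrow> real \<Rightarrow> (real \<Rightarrow> real) \<Rightarrow> ennreal" where
  "risk \<sigma> \<theta> \<delta> = (\<integral>\<^sup>+ x. ennreal ((\<delta> x - \<theta>)\<^sup>2) \<partial>normal_law \<theta> \<sigma>)"

definition dominates :: "real \<Rightarrow> real set \<Rightarrow> (real \<Rightarrow> real) \<Rightarrow> (real \<Rightarrow> real) \<Rightarrow> bool" where
  "dominates \<sigma> \<Theta> \<delta> \<delta>' \<longleftrightarrow> estimator \<delta> \<and> estimator \<delta>' \<and>
     (\<forall>\<theta>\<in>\<Theta>. risk \<sigma> \<theta> \<delta> \<le> risk \<sigma> \<theta> \<delta>') \<and>
     (\<exists>\<theta>\<in>\<Theta>. risk \<sigma> \<theta> \<delta> < risk \<sigma> \<theta> \<delta>')"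

definition minimax :: "real \<Rightarrow> real set \<Rightarrow> (real \<Rightarrow> real) \<Rightarrow> bool" where
  "minimax \<sigma> \<Theta> \<delta> \<longleftrightarrow> estimator \<delta> \<and>
     (SUP \<theta>\<in>\<Theta>. risk \<sigma> \<theta> \<delta>) = (INF \<delta>'\<in>Collect estimator. SUP \<theta>\<in>\<Theta>. risk \<sigma> \<theta> \<delta>')"

definition delta_est :: "real \<Rightarrow> real \<Rightarrow> real \<Rightarrow> real" where
  "delta_est \<sigma> c x = x + c * \<sigma> * inverse_mills (c * x / \<sigma>)"

end

theory Submission
  imports Defs "HOL-Real_Asymp.Real_Asymp"
begin

text \<open>
  Write \<open>R\<close> for \<^const>\<open>inverse_mills\<close>, \<open>r(x) = R(c x / \<sigma>)\<close>, and expand the square in the risk of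
  \<open>\<delta>\<^sub>c = X + c \<sigma> r(X)\<close>:
  the difference to the constant risk \<open>\<sigma>\<^sup>2\<close> of \<open>X\<close> is \<open>c \<sigma> (2 A + c \<sigma> B)\<close>, where
  \<open>A = E[(X - \<theta>) r(X)]\<close> and \<open>B = E[r(X)\<^sup>2]\<close>. Because \<open>R' = - R (t + R)\<close>, Stein's identity
  \<open>E[(X - \<theta>) r(X)] = \<sigma>\<^sup>2 E[r'(X)]\<close> is a linear relation between \<open>A\<close>, \<open>B\<close> and \<open>E[r(X)]\<close>.
  Eliminating \<open>B\<close> with it turns the difference into
  \<open>c \<sigma> ((1 - c\<^sup>2) A - c\<^sup>2 \<theta> E[r(X)])\<close> (lemma \<open>risk_delta_est\<close>). Both summands have a sign:
  \<open>A\<close> is the covariance of \<open>X\<close> with a decreasing function of \<open>X\<close>, so \<open>A \<le> 0\<close>, and \<open>E[r(X)] > 0\<close>.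
  Hence for \<open>c \<le> 1\<close> and \<open>\<theta> \<ge> 0\<close> the risk does not exceed \<open>\<sigma>\<^sup>2\<close>, strictly for \<open>\<theta> > 0\<close>.

  The analytic facts about \<open>R\<close> come from the formula
  \<open>1 / R(t) = \<integral> exp (t u - u\<^sup>2 / 2) du over u \<ge> 0\<close>. Its integrand increases with \<open>t\<close>, so \<open>R\<close> decreases;
  bounding it from below near \<open>u = 0\<close> shows that \<open>R\<close> grows at most linearly, which makes all
  expectations finite and kills the boundary terms in Stein's identity.

  For minimaxity it remains to see that no estimator has risk at most \<open>r < \<sigma>\<^sup>2\<close> on the whole half
  line (lemma \<open>uniform_risk_bound_ge\<close>). Such a bound also bounds the bias uniformly, so over a long
  stretch of \<open>n\<close> steps of length \<open>h\<close> the mean of the estimator grows by \<open>n h + O(1)\<close>. The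
  Chapman-Robbins inequality, on the other hand, limits the growth in each step in terms of \<open>r\<close> and
  \<open>exp (h\<^sup>2 / \<sigma>\<^sup>2) - 1\<close>. Summing the steps, dividing by \<open>n\<close>, and letting first \<open>n \<rightarrow> \<infinity>\<close> and then
  \<open>h \<rightarrow> 0\<close> gives \<open>r \<ge> \<sigma>\<^sup>2\<close>.
\<close>

section \<open>Mills' ratio of the normal distribution\<close>

text \<open>Mills' ratio in the sense of \<open>\<Phi> / \<phi>\<close>: substitute \<open>x = t - u\<close> in \<open>\<Phi>(t) = \<integral> \<phi>(x) dx over x \<le> t\<close> and divide
  by \<open>\<phi>(t)\<close>. In this form the dependence on \<open>t\<close> sits in one monotone factor of the integrand.\<close>
definition mills_ratio :: "real \<Rightarrow> real" where
  "mills_ratio t = (LBINT u. exp (t * u - u\<^sup>2 / 2) * indicator {0..} u)"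

lemma std_normal_density_shift:
  "std_normal_density (t - u) = std_normal_density t * exp (t * u - u\<^sup>2 / 2)"
proof -
  have "- (t - u)\<^sup>2 / 2 = - t\<^sup>2 / 2 + (t * u - u\<^sup>2 / 2)"
    by (simp add: power2_eq_square field_simps)
  then show ?thesis
    by (simp only: std_normal_density_def exp_add mult.assoc)
qed

lemma std_normal_density_pos: "0 < std_normal_density t"
  by (rule normal_density_pos) simp

lemma integrable_mills_kernel:
  "integrable lborel (\<lambda>u. exp (t * u - u\<^sup>2 / 2) * indicator {0..} u :: real)"
proof -
  have "integrable lborel (\<lambda>u. std_normal_density (t + (-1) * u))"
    by (rule lborel_integrable_real_affine) (auto intro: integrable_normal_density)
  then have "integrable lborel (\<lambda>u. std_normal_density (t - u) / std_normal_density t)"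
    by (intro integrable_divide) simp
  then have "integrable lborel (\<lambda>u. exp (t * u - u\<^sup>2 / 2))"
    using std_normal_density_pos[of t] by (simp add: std_normal_density_shift)
  then show ?thesis
    by (rule integrable_real_mult_indicator[rotated]) simp
qed

lemma cdf_std_normal_eq_LBINT:
  "cdf std_normal_distribution t = (LBINT x. std_normal_density x * indicator {..t} x)"
proof -
  interpret prob_space std_normal_distribution
    by (rule prob_space_normal_density) simp
  have "cdf std_normal_distribution t = (LINT x|std_normal_distribution. indicator {..t} x)"
    by (simp add: cdf_def2)
  also have "\<dots> = (LBINT x. std_normal_density x *\<^sub>R indicator {..t} x)"
    by (rule integral_density) auto
  finally show ?thesis by simp
qed

lemma cdf_std_normal_eq_mills_ratio:
  "cdf std_normal_distribution t = std_normal_density t * mills_ratio t"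
proof -
  have "cdf std_normal_distribution t
      = (LBINT u. std_normal_density (t + (-1) * u) * indicator {..t} (t + (-1) * u))"
    unfolding cdf_std_normal_eq_LBINT
    by (subst lborel_integral_real_affine[of "-1" _ t]) auto
  also have "\<dots> = (LBINT u. std_normal_density t * (exp (t * u - u\<^sup>2 / 2) * indicator {0..} u))"
    using std_normal_density_shift[of t]
    by (intro Bochner_Integration.integral_cong) (auto simp: indicator_def)
  finally show ?thesis
    by (simp add: mills_ratio_def)
qed

lemma inverse_mills_eq: "inverse_mills t = 1 / mills_ratio t"
  using std_normal_density_pos[of t]
  by (simp add: inverse_mills_def cdf_std_normal_eq_mills_ratio)

lemma mills_ratio_mono: "s \<le> t \<Longrightarrow> mills_ratio s \<le> mills_ratio t"
  unfolding mills_ratio_def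
  by (intro integral_mono integrable_mills_kernel)
     (auto simp: indicator_def intro: mult_right_mono)

text \<open>The interval \<open>[0, h]\<close> with \<open>h = 1 / (1 + \<bar>t\<bar>)\<close> is short enough for the exponent
  \<open>t u - u\<^sup>2 / 2\<close> to stay above \<open>- 3 / 2\<close>, and contributes already the order \<open>1 / (1 + \<bar>t\<bar>)\<close>.\<close>
lemma mills_ratio_lower_bound: "exp (- 3 / 2) / (1 + \<bar>t\<bar>) \<le> mills_ratio t"
proof -
  define h where "h = 1 / (1 + \<bar>t\<bar>)"
  have h: "0 < h" "h \<le> 1" "\<bar>t\<bar> * h \<le> 1"
    by (auto simp: h_def field_simps)
  have "exp (- 3 / 2) * h = (LBINT u. exp (- 3 / 2) * indicator {0..h} u)"
    using h by simp
  also have "\<dots> \<le> mills_ratio t"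
    unfolding mills_ratio_def
  proof (intro integral_mono integrable_mills_kernel)
    show "integrable lborel (\<lambda>u. exp (- 3 / 2) * indicator {0..h} u :: real)"
      using h by (intro integrable_mult_right integrable_real_indicator) auto
    fix u :: real
    have "- 3 / 2 \<le> t * u - u\<^sup>2 / 2" if "0 \<le> u" "u \<le> h"
    proof -
      have "\<bar>t * u\<bar> \<le> \<bar>t\<bar> * h"
        using that by (simp add: abs_mult mult_left_mono)
      moreover have "u\<^sup>2 \<le> 1"
        using that h by (intro power_le_one) auto
      ultimately show ?thesis using h by linarith
    qed
    then show "exp (- 3 / 2) * indicator {0..h} u \<le> exp (t * u - u\<^sup>2 / 2) * indicator {0..} u"
      by (auto simp: indicator_def)
  qed
  finally show ?thesis by (simp add: h_def)
qed

lemma mills_ratio_pos: "0 < mills_ratio t"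
  by (rule less_le_trans[OF _ mills_ratio_lower_bound]) (simp add: add_pos_nonneg)

lemma inverse_mills_pos: "0 < inverse_mills t"
  by (simp add: inverse_mills_eq mills_ratio_pos)

lemma inverse_mills_antimono: "s \<le> t \<Longrightarrow> inverse_mills t \<le> inverse_mills s"
  unfolding inverse_mills_eq
  by (intro divide_left_mono mills_ratio_mono mult_pos_pos mills_ratio_pos) auto

lemma inverse_mills_le: "inverse_mills t \<le> exp (3 / 2) * (1 + \<bar>t\<bar>)"
proof -
  have "inverse_mills t \<le> 1 / (exp (- 3 / 2) / (1 + \<bar>t\<bar>))"
    unfolding inverse_mills_eq
    by (intro divide_left_mono mills_ratio_lower_bound mult_pos_pos mills_ratio_pos)
       (auto simp: add_pos_nonneg)
  then show ?thesis by (simp add: exp_minus field_simps)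
qed

section \<open>The derivative of the inverse Mills ratio\<close>
lemma normal_density_has_derivative:
  assumes "\<sigma> > 0"
  shows "(normal_density \<theta> \<sigma> has_real_derivative - ((x - \<theta>) / \<sigma>\<^sup>2) * normal_density \<theta> \<sigma> x) (at x)"
proof -
  have "((\<lambda>x. - (x - \<theta>)\<^sup>2 / (2 * \<sigma>\<^sup>2)) has_real_derivative - ((x - \<theta>) / \<sigma>\<^sup>2)) (at x)"
    using assms by (auto intro!: derivative_eq_intros simp: field_simps)
  from DERIV_cmult[OF DERIV_chain2[OF DERIV_exp this], of "1 / sqrt (2 * pi * \<sigma>\<^sup>2)"]
  show ?thesis
    unfolding normal_density_def[abs_def] by (simp add: mult_ac)
qed

lemma isCont_normal_density: "\<sigma> > 0 \<Longrightarrow> isCont (normal_density \<theta> \<sigma>) x"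
  using normal_density_has_derivative DERIV_isCont by blast

lemma cdf_std_normal_has_derivative:
  "(cdf std_normal_distribution has_real_derivative std_normal_density x) (at x)"
proof -
  define a where "a = x - 1"
  interpret prob_space std_normal_distribution
    by (rule prob_space_normal_density) simp
  interpret finite_borel_measure std_normal_distribution
    by unfold_locales auto
  have int: "integrable lborel std_normal_density" by simp
  have *: "cdf std_normal_distribution y
      = cdf std_normal_distribution a + integral {a..y} std_normal_density" if "a < y" for y
  proof -
    have "cdf std_normal_distribution y - cdf std_normal_distribution a
        = (LBINT u. std_normal_density u * indicator {..y} u - std_normal_density u * indicator {..a} u)"
      unfolding cdf_std_normal_eq_LBINT
      by (intro Bochner_Integration.integral_diff[symmetric] integrable_real_mult_indicator int) auto
    also have "\<dots> = (LBINT u:{a<..y}. std_normal_density u)"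
      unfolding set_lebesgue_integral_def
      using that by (intro Bochner_Integration.integral_cong) (auto simp: indicator_def)
    also have "\<dots> = integral {a<..y} std_normal_density"
      using int by (intro set_borel_integral_eq_integral)
         (auto simp: set_integrable_def mult.commute intro!: integrable_real_mult_indicator)
    also have "\<dots> = integral {a..y} std_normal_density"
      by (rule integral_subset_negligible[of "{a<..y}" "{a..y}"])
         (auto intro: negligible_subset[of "{a}"])
    finally show ?thesis by simp
  qed
  have "((\<lambda>y. integral {a..y} std_normal_density) has_real_derivative std_normal_density x)
     (at x within {a..x + 1})"
    by (intro integral_has_real_derivative continuous_at_imp_continuous_on)
       (auto simp: a_def intro: isCont_normal_density)
  then have "((\<lambda>y. integral {a..y} std_normal_density) has_real_derivative std_normal_density x) (at x)"
    by (simp add: at_within_Icc_at a_def)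
  then have "((\<lambda>y. cdf std_normal_distribution a + integral {a..y} std_normal_density)
      has_real_derivative std_normal_density x) (at x)"
    by (auto intro!: derivative_eq_intros)
  then show ?thesis
    by (rule has_field_derivative_transform_within_open[of _ _ _ "{a<..}"])
       (auto simp: * a_def)
qed

lemma inverse_mills_has_derivative:
  "(inverse_mills has_real_derivative - inverse_mills t * (t + inverse_mills t)) (at t)"
proof -
  have "cdf std_normal_distribution t > 0"
    by (simp add: cdf_std_normal_eq_mills_ratio std_normal_density_pos mills_ratio_pos)
  then show ?thesis
    unfolding inverse_mills_def[abs_def]
    by (auto intro!: derivative_eq_intros normal_density_has_derivative cdf_std_normal_has_derivative
      simp: field_simps power2_eq_square)
qed

lemma isCont_inverse_mills: "isCont inverse_mills t"
  using inverse_mills_has_derivative DERIV_isCont by blast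

lemma borel_measurable_inverse_mills [measurable]: "inverse_mills \<in> borel_measurable borel"
  by (intro borel_measurable_continuous_onI continuous_at_imp_continuous_on ballI isCont_inverse_mills)

section \<open>Functions of linear growth under a normal law\<close>

text \<open>The majorant is expressed through \<open>(x - \<theta>)\<^sup>2\<close>, whose integral against the normal density
  with mean \<open>\<theta>\<close> is the variance.\<close>
lemma linear_growth_mult_le:
  fixes u v x \<theta> :: real
  assumes "\<bar>u\<bar> \<le> A * (1 + \<bar>x\<bar>)" "\<bar>v\<bar> \<le> B * (1 + \<bar>x\<bar>)" "0 \<le> A" "0 \<le> B"
  shows "\<bar>u * v\<bar> \<le> A * B * (2 * (1 + \<bar>\<theta>\<bar>)\<^sup>2 + 2 * (x - \<theta>)\<^sup>2)"
proof -
  have "(1 + \<bar>x\<bar>)\<^sup>2 \<le> ((1 + \<bar>\<theta>\<bar>) + \<bar>x - \<theta>\<bar>)\<^sup>2"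
    by (intro power_mono) auto
  also have "\<dots> \<le> 2 * (1 + \<bar>\<theta>\<bar>)\<^sup>2 + 2 * (x - \<theta>)\<^sup>2"
    using sum_squares_bound[of "1 + \<bar>\<theta>\<bar>" "\<bar>x - \<theta>\<bar>"] by (simp add: power2_sum)
  finally have "A * B * (1 + \<bar>x\<bar>)\<^sup>2 \<le> A * B * (2 * (1 + \<bar>\<theta>\<bar>)\<^sup>2 + 2 * (x - \<theta>)\<^sup>2)"
    using assms by (intro mult_left_mono) auto
  moreover have "\<bar>u * v\<bar> \<le> (A * (1 + \<bar>x\<bar>)) * (B * (1 + \<bar>x\<bar>))"
    unfolding abs_mult using assms by (intro mult_mono) auto
  ultimately show ?thesis
    by (simp add: power2_eq_square mult_ac)
qed

text \<open>A class that contains the inverse Mills ratio and the centred identity, and whose pairwise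
  products, which occur in the squared error, are integrable against every normal density.\<close>
definition linear_growth :: "(real \<Rightarrow> real) \<Rightarrow> bool" where
  "linear_growth f \<longleftrightarrow> f \<in> borel_measurable borel \<and> (\<exists>A\<ge>0. \<forall>x. \<bar>f x\<bar> \<le> A * (1 + \<bar>x\<bar>))"

lemma linear_growth_const: "linear_growth (\<lambda>x. a)"
  unfolding linear_growth_def by (auto intro!: exI[of _ "\<bar>a\<bar>"] simp: algebra_simps)

lemma linear_growth_centred: "linear_growth (\<lambda>x. x - \<theta>)"
proof -
  have "\<bar>x - \<theta>\<bar> \<le> (1 + \<bar>\<theta>\<bar>) * (1 + \<bar>x\<bar>)" for x
  proof -
    have "0 \<le> \<bar>\<theta>\<bar> * \<bar>x\<bar>" by simp
    moreover have "\<bar>x - \<theta>\<bar> \<le> \<bar>x\<bar> + \<bar>\<theta>\<bar>" by simp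
    moreover have "(1 + \<bar>\<theta>\<bar>) * (1 + \<bar>x\<bar>) = 1 + \<bar>\<theta>\<bar> + \<bar>x\<bar> + \<bar>\<theta>\<bar> * \<bar>x\<bar>"
      by (simp add: algebra_simps)
    ultimately show ?thesis by linarith
  qed
  then show ?thesis
    unfolding linear_growth_def by (intro conjI exI[of _ "1 + \<bar>\<theta>\<bar>"]) auto
qed

lemma linear_growth_inverse_mills: "linear_growth (\<lambda>x. inverse_mills (b * x))"
proof -
  have "\<bar>inverse_mills (b * x)\<bar> \<le> exp (3 / 2) * (1 + \<bar>b\<bar>) * (1 + \<bar>x\<bar>)" for x
  proof -
    have "\<bar>inverse_mills (b * x)\<bar> \<le> exp (3 / 2) * (1 + \<bar>b * x\<bar>)"
      using inverse_mills_le[of "b * x"] inverse_mills_pos[of "b * x"] by simp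
    also have "\<dots> \<le> exp (3 / 2) * ((1 + \<bar>b\<bar>) * (1 + \<bar>x\<bar>))"
      by (intro mult_left_mono) (auto simp: abs_mult algebra_simps)
    finally show ?thesis by (simp only: mult.assoc)
  qed
  then show ?thesis
    unfolding linear_growth_def by (intro conjI exI[of _ "exp (3 / 2) * (1 + \<bar>b\<bar>)"]) auto
qed

lemma integrable_normal_linear_growth_mult:
  assumes "\<sigma> > 0" "linear_growth f" "linear_growth g"
  shows "integrable lborel (\<lambda>x. normal_density \<theta> \<sigma> x * (f x * g x))"
proof -
  obtain A B where "0 \<le> A" "0 \<le> B" and AB: "\<And>x. \<bar>f x\<bar> \<le> A * (1 + \<bar>x\<bar>)" "\<And>x. \<bar>g x\<bar> \<le> B * (1 + \<bar>x\<bar>)"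
    and [measurable]: "f \<in> borel_measurable borel" "g \<in> borel_measurable borel"
    using assms unfolding linear_growth_def by blast
  have "integrable lborel (\<lambda>x. A * B * 2 * (1 + \<bar>\<theta>\<bar>)\<^sup>2 * normal_density \<theta> \<sigma> x
      + A * B * 2 * (normal_density \<theta> \<sigma> x * (x - \<theta>)\<^sup>2))"
    using assms(1) by (intro Bochner_Integration.integrable_add integrable_mult_right
      integrable_normal_density integrable_normal_moment)
  then have *: "integrable lborel (\<lambda>x. normal_density \<theta> \<sigma> x * (A * B * (2 * (1 + \<bar>\<theta>\<bar>)\<^sup>2 + 2 * (x - \<theta>)\<^sup>2)))"
    by (simp add: algebra_simps)
  show ?thesis
  proof (rule Bochner_Integration.integrable_bound[OF *])
    show "AE x in lborel. norm (normal_density \<theta> \<sigma> x * (f x * g x))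
       \<le> norm (normal_density \<theta> \<sigma> x * (A * B * (2 * (1 + \<bar>\<theta>\<bar>)\<^sup>2 + 2 * (x - \<theta>)\<^sup>2)))"
    proof (rule AE_I2)
      fix x
      have "\<bar>f x * g x\<bar> \<le> \<bar>A * B * (2 * (1 + \<bar>\<theta>\<bar>)\<^sup>2 + 2 * (x - \<theta>)\<^sup>2)\<bar>"
        using linear_growth_mult_le[OF AB(1)[of x] AB(2)[of x] \<open>0 \<le> A\<close> \<open>0 \<le> B\<close>, of \<theta>] by linarith
      then show "norm (normal_density \<theta> \<sigma> x * (f x * g x))
         \<le> norm (normal_density \<theta> \<sigma> x * (A * B * (2 * (1 + \<bar>\<theta>\<bar>)\<^sup>2 + 2 * (x - \<theta>)\<^sup>2)))"
        by (simp only: real_norm_def abs_mult[of "normal_density \<theta> \<sigma> x"]) (intro mult_left_mono; simp)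
    qed
  qed measurable
qed

lemma integrable_normal_linear_growth:
  assumes "\<sigma> > 0" "linear_growth f"
  shows "integrable lborel (\<lambda>x. normal_density \<theta> \<sigma> x * f x)"
  using integrable_normal_linear_growth_mult[OF assms linear_growth_const[of 1]] by simp

lemma normal_density_linear_tendsto_0:
  assumes "\<sigma> > 0"
  shows "((\<lambda>x. normal_density \<theta> \<sigma> x * (A * (1 + \<bar>x\<bar>))) \<longlongrightarrow> 0) at_top"
    "((\<lambda>x. normal_density \<theta> \<sigma> x * (A * (1 + \<bar>x\<bar>))) \<longlongrightarrow> 0) at_bot"
  using assms unfolding normal_density_def by real_asymp+

text \<open>The boundary terms of the integration by parts below.\<close>
lemma normal_density_linear_growth_tendsto_0:
  assumes "\<sigma> > 0" "linear_growth f"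
  shows "((\<lambda>x. normal_density \<theta> \<sigma> x * f x) \<longlongrightarrow> 0) at_top"
    "((\<lambda>x. normal_density \<theta> \<sigma> x * f x) \<longlongrightarrow> 0) at_bot"
proof -
  obtain A where A: "\<And>x. \<bar>f x\<bar> \<le> A * (1 + \<bar>x\<bar>)"
    using assms unfolding linear_growth_def by blast
  have *: "norm (normal_density \<theta> \<sigma> x * f x) \<le> normal_density \<theta> \<sigma> x * (A * (1 + \<bar>x\<bar>))" for x
    using A[of x] by (simp add: abs_mult mult_left_mono)
  show "((\<lambda>x. normal_density \<theta> \<sigma> x * f x) \<longlongrightarrow> 0) at_top"
    by (rule Lim_null_comparison[OF always_eventually normal_density_linear_tendsto_0(1)[OF assms(1)]])
       (use * in blast)
  show "((\<lambda>x. normal_density \<theta> \<sigma> x * f x) \<longlongrightarrow> 0) at_bot"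
    by (rule Lim_null_comparison[OF always_eventually normal_density_linear_tendsto_0(2)[OF assms(1)]])
       (use * in blast)
qed

section \<open>Stein's identity and the sign of a covariance\<close>

text \<open>Integration by parts: the normal density \<open>p\<close> satisfies \<open>p' = - (x - \<theta>) p / \<sigma>\<^sup>2\<close>, so the
  integrand \<open>p f' - (x - \<theta>) p f / \<sigma>\<^sup>2\<close> is the derivative of \<open>p f\<close>, which vanishes at both
  ends of the line.\<close>
lemma stein_identity:
  assumes "\<sigma> > 0" and f: "linear_growth f"
    and f': "\<And>x. (f has_real_derivative f' x) (at x)" "\<And>x. isCont f' x"
    and int: "integrable lborel (\<lambda>x. normal_density \<theta> \<sigma> x * f' x)"
  shows "(LBINT x. normal_density \<theta> \<sigma> x * ((x - \<theta>) * f x))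
       = \<sigma>\<^sup>2 * (LBINT x. normal_density \<theta> \<sigma> x * f' x)"
proof -
  let ?p = "normal_density \<theta> \<sigma>"
  define F' where "F' x = ?p x * f' x - 1 / \<sigma>\<^sup>2 * (?p x * ((x - \<theta>) * f x))" for x
  then have int': "integrable lborel (\<lambda>x. ?p x * ((x - \<theta>) * f x))"
    using assms by (intro integrable_normal_linear_growth_mult linear_growth_centred)
  have intF': "integrable lborel F'"
    unfolding F'_def using int int' by (intro Bochner_Integration.integrable_diff integrable_mult_right)
  have "(LBINT x=-\<infinity>..\<infinity>. F' x) = 0 - 0"
  proof (rule interval_integral_FTC_integrable[where F = "\<lambda>x. ?p x * f x"])
    fix x
    have "((\<lambda>x. ?p x * f x) has_real_derivative F' x) (at x)"
      unfolding F'_def using assms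
      by (auto intro!: derivative_eq_intros normal_density_has_derivative f' simp: mult_ac)
    then show "((\<lambda>x. ?p x * f x) has_vector_derivative F' x) (at x)"
      by (simp add: has_real_derivative_iff_has_vector_derivative)
    show "isCont F' x"
      unfolding F'_def using assms DERIV_isCont[OF f'(1)]
      by (intro continuous_intros isCont_normal_density f'(2)) auto
  next
    show "set_integrable lborel (einterval (- \<infinity>) \<infinity>) F'"
      using intF' by (simp add: set_integrable_def)
    show "(((\<lambda>x. ?p x * f x) \<circ> real_of_ereal) \<longlongrightarrow> 0) (at_right (- \<infinity>))"
      "(((\<lambda>x. ?p x * f x) \<circ> real_of_ereal) \<longlongrightarrow> 0) (at_left \<infinity>)"
      using normal_density_linear_growth_tendsto_0[OF assms(1) f]
      by (simp_all add: ereal_tendsto_simps)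
  qed simp
  then have "(LBINT x. F' x) = 0"
    by (simp add: interval_lebesgue_integral_def set_lebesgue_integral_def)
  moreover have "(LBINT x. F' x) = (LBINT x. ?p x * f' x) - 1 / \<sigma>\<^sup>2 * (LBINT x. ?p x * ((x - \<theta>) * f x))"
    unfolding F'_def using int int' by simp
  ultimately show ?thesis
    using assms(1) by (simp add: field_simps)
qed

text \<open>Since \<open>X - \<theta>\<close> has mean zero, \<open>f(X)\<close> may be replaced by \<open>f(X) - f(\<theta>)\<close>, whose sign is
  opposite to that of \<open>X - \<theta>\<close> at every point.\<close>
lemma normal_covariance_antimono_nonpos:
  assumes "\<sigma> > 0" and f: "linear_growth f" "antimono f"
  shows "(LBINT x. normal_density \<theta> \<sigma> x * ((x - \<theta>) * f x)) \<le> 0"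
proof -
  let ?p = "normal_density \<theta> \<sigma>"
  have "(LBINT x. ?p x * ((x - \<theta>) * f x)) \<le> (LBINT x. f \<theta> * (?p x * (x - \<theta>)))"
  proof (intro integral_mono integrable_mult_right integrable_normal_linear_growth_mult
      integrable_normal_linear_growth linear_growth_centred assms)
    fix x
    have "(x - \<theta>) * (f x - f \<theta>) \<le> 0"
      using monotoneD[OF f(2)] by (cases "x \<le> \<theta>") (auto simp: mult_le_0_iff)
    then have "?p x * ((x - \<theta>) * (f x - f \<theta>)) \<le> 0"
      by (simp add: mult_nonneg_nonpos)
    then show "?p x * ((x - \<theta>) * f x) \<le> f \<theta> * (?p x * (x - \<theta>))"
      by (simp add: algebra_simps)
  qed
  also have "\<dots> = 0"
    using integral_normal_moment_odd[OF assms(1), of \<theta> 0] by simp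
  finally show ?thesis .
qed

section \<open>Risk below the variance\<close>
lemma risk_eq_nn_integral:
  assumes "\<sigma> > 0" "estimator \<delta>"
  shows "risk \<sigma> \<theta> \<delta> = (\<integral>\<^sup>+ x. ennreal (normal_density \<theta> \<sigma> x * (\<delta> x - \<theta>)\<^sup>2) \<partial>lborel)"
proof -
  have [measurable]: "\<delta> \<in> borel_measurable borel"
    using assms(2) by (simp add: estimator_def)
  show ?thesis
    unfolding risk_def normal_law_def
    by (subst nn_integral_density) (auto simp: ennreal_mult)
qed

lemma risk_eq_LBINT:
  assumes "\<sigma> > 0" "estimator \<delta>" "integrable lborel (\<lambda>x. normal_density \<theta> \<sigma> x * (\<delta> x - \<theta>)\<^sup>2)"
  shows "risk \<sigma> \<theta> \<delta> = ennreal (LBINT x. normal_density \<theta> \<sigma> x * (\<delta> x - \<theta>)\<^sup>2)"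
  unfolding risk_eq_nn_integral[OF assms(1,2)]
  by (rule nn_integral_eq_integral[OF assms(3)]) simp

lemma normal_variance:
  assumes "\<sigma> > 0"
  shows "(LBINT x. normal_density \<theta> \<sigma> x * (x - \<theta>)\<^sup>2) = \<sigma>\<^sup>2"
  using integral_normal_moment_even[OF assms, of \<theta> 1] by simp

lemma risk_ident:
  assumes "\<sigma> > 0"
  shows "risk \<sigma> \<theta> (\<lambda>x. x) = ennreal (\<sigma>\<^sup>2)"
  using risk_eq_LBINT[OF assms, of "\<lambda>x. x" \<theta>] integrable_normal_moment[OF assms, of \<theta> 2]
  by (simp add: normal_variance[OF assms] estimator_def)

lemma estimator_delta_est: "estimator (delta_est \<sigma> c)"
  unfolding estimator_def delta_est_def[abs_def] by measurable

text \<open>Expanding the square produces the unknown \<open>E[r(X)\<^sup>2]\<close>, whose sign is unfavourable. The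
  differential equation \<open>R' = - R (t + R)\<close> makes it appear also in Stein's identity for \<open>r\<close>,
  so that it can be eliminated; what is left are two terms of known sign.\<close>
lemma risk_delta_est:
  fixes \<sigma> c \<theta> :: real
  assumes "\<sigma> > 0" "0 < c"
  defines "r \<equiv> \<lambda>x. inverse_mills (c * x / \<sigma>)"
  shows "risk \<sigma> \<theta> (delta_est \<sigma> c) = ennreal (\<sigma>\<^sup>2 + c * \<sigma> *
    ((1 - c\<^sup>2) * (LBINT x. normal_density \<theta> \<sigma> x * ((x - \<theta>) * r x))
      - c\<^sup>2 * \<theta> * (LBINT x. normal_density \<theta> \<sigma> x * r x)))"
proof -
  let ?p = "normal_density \<theta> \<sigma>"
  have r: "linear_growth r"
    using linear_growth_inverse_mills[of "c / \<sigma>"] by (simp add: r_def)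
  note int = integrable_normal_linear_growth_mult[OF assms(1)]
  have intA: "integrable lborel (\<lambda>x. ?p x * ((x - \<theta>) * r x))"
    and intB: "integrable lborel (\<lambda>x. ?p x * (r x * r x))"
    and intD: "integrable lborel (\<lambda>x. ?p x * ((x - \<theta>) * (x - \<theta>)))"
    and intE: "integrable lborel (\<lambda>x. ?p x * r x)"
    by (intro int r linear_growth_centred integrable_normal_linear_growth assms)+
  define A where "A = (LBINT x. ?p x * ((x - \<theta>) * r x))"
  define B where "B = (LBINT x. ?p x * (r x * r x))"
  define E where "E = (LBINT x. ?p x * r x)"
  \<comment> \<open>the derivative of \<^term>\<open>r\<close>, by the chain rule and \<open>R' = - R (t + R)\<close>\<close>
  define r' where "r' x = c / \<sigma> * (- r x * (c * x / \<sigma> + r x))" for x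
  have p_r': "?p x * r' x = - (c / \<sigma>)\<^sup>2 * (?p x * ((x - \<theta>) * r x))
       - (c / \<sigma>)\<^sup>2 * \<theta> * (?p x * r x) - c / \<sigma> * (?p x * (r x * r x))" for x
    using assms by (simp add: r'_def field_simps power2_eq_square)
  have deriv: "(r has_real_derivative r' x) (at x)" for x
  proof -
    have "((\<lambda>x. c * x / \<sigma>) has_real_derivative c / \<sigma>) (at x)"
      using assms(1) by (auto intro!: derivative_eq_intros)
    from DERIV_chain2[OF inverse_mills_has_derivative this] show ?thesis
      unfolding r_def r'_def by (simp add: mult_ac)
  qed
  have "A = \<sigma>\<^sup>2 * (LBINT x. ?p x * r' x)"
    unfolding A_def
  proof (rule stein_identity[OF assms(1) r])
    fix x
    show "(r has_real_derivative r' x) (at x)" by (rule deriv)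
    show "isCont r' x"
      unfolding r'_def using DERIV_isCont[OF deriv] assms by (intro continuous_intros) auto
    show "integrable lborel (\<lambda>x. ?p x * r' x)"
      unfolding p_r' by (intro Bochner_Integration.integrable_diff integrable_mult_right intA intB intE)
  qed
  also have "(LBINT x. ?p x * r' x) = - (c / \<sigma>)\<^sup>2 * A - (c / \<sigma>)\<^sup>2 * \<theta> * E - c / \<sigma> * B"
    unfolding p_r' A_def B_def E_def using intA intB intE by simp
  also have "\<sigma>\<^sup>2 * \<dots> = - c\<^sup>2 * A - c\<^sup>2 * \<theta> * E - c * \<sigma> * B"
    using assms(1) by (simp add: field_simps power2_eq_square)
  finally have stein: "c * \<sigma> * B = - A - c\<^sup>2 * A - c\<^sup>2 * \<theta> * E"
    by linarith
  have expand: "?p x * (delta_est \<sigma> c x - \<theta>)\<^sup>2 = ?p x * ((x - \<theta>) * (x - \<theta>))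
      + 2 * c * \<sigma> * (?p x * ((x - \<theta>) * r x)) + (c * \<sigma>)\<^sup>2 * (?p x * (r x * r x))" for x
  proof -
    have "delta_est \<sigma> c x = x + c * \<sigma> * r x"
      by (simp add: delta_est_def r_def)
    then show ?thesis by algebra
  qed
  have "integrable lborel (\<lambda>x. ?p x * (delta_est \<sigma> c x - \<theta>)\<^sup>2)"
    unfolding expand by (intro Bochner_Integration.integrable_add integrable_mult_right intA intB intD)
  then have "risk \<sigma> \<theta> (delta_est \<sigma> c) = ennreal (LBINT x. ?p x * (delta_est \<sigma> c x - \<theta>)\<^sup>2)"
    by (rule risk_eq_LBINT[OF assms(1) estimator_delta_est])
  also have "(LBINT x. ?p x * (delta_est \<sigma> c x - \<theta>)\<^sup>2) = \<sigma>\<^sup>2 + 2 * c * \<sigma> * A + (c * \<sigma>)\<^sup>2 * B"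
    unfolding expand A_def B_def using intA intB intD normal_variance[OF assms(1), of \<theta>]
    by (simp add: power2_eq_square)
  also have "\<dots> = \<sigma>\<^sup>2 + c * \<sigma> * (2 * A + c * \<sigma> * B)"
    by (simp add: power2_eq_square algebra_simps)
  also have "\<dots> = \<sigma>\<^sup>2 + c * \<sigma> * ((1 - c\<^sup>2) * A - c\<^sup>2 * \<theta> * E)"
    unfolding stein by (simp add: algebra_simps)
  finally show ?thesis
    by (simp only: A_def E_def)
qed

text \<open>Strict positivity is what makes the domination strict at \<open>\<theta> = 1\<close>, also for \<open>c = 1\<close>, when the
  covariance term drops out.\<close>
lemma LBINT_normal_inverse_mills_pos:
  assumes "\<sigma> > 0"
  shows "0 < (LBINT x. normal_density \<theta> \<sigma> x * inverse_mills (c * x / \<sigma>))"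
proof -
  let ?f = "\<lambda>x. normal_density \<theta> \<sigma> x * inverse_mills (c * x / \<sigma>)"
  have pos: "0 < ?f x" for x
    using assms by (intro mult_pos_pos normal_density_pos inverse_mills_pos)
  have "integrable lborel ?f"
    using integrable_normal_linear_growth[OF assms linear_growth_inverse_mills[of "c / \<sigma>"]] by simp
  then have "(LBINT x. ?f x) = 0 \<longleftrightarrow> (AE x in lborel. ?f x = 0)"
    using pos by (intro integral_nonneg_eq_0_iff_AE) (auto intro: less_imp_le)
  moreover have "\<not> (AE x in lborel. ?f x = 0)"
    by (simp only: less_imp_neq[OF pos, symmetric] eventually_False ae_filter_eq_bot_iff) simp
  moreover have "0 \<le> (LBINT x. ?f x)"
    using pos by (intro Bochner_Integration.integral_nonneg) (auto intro: less_imp_le)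
  ultimately show ?thesis by linarith
qed

lemma delta_est_dominates_ident:
  assumes "\<sigma> > 0" "0 < c" "c \<le> 1"
  shows "dominates \<sigma> {0..} (delta_est \<sigma> c) (\<lambda>x. x)"
proof -
  let ?A = "\<lambda>\<theta>. LBINT x. normal_density \<theta> \<sigma> x * ((x - \<theta>) * inverse_mills (c * x / \<sigma>))"
  let ?E = "\<lambda>\<theta>. LBINT x. normal_density \<theta> \<sigma> x * inverse_mills (c * x / \<sigma>)"
  let ?d = "\<lambda>\<theta>. c * \<sigma> * ((1 - c\<^sup>2) * ?A \<theta> - c\<^sup>2 * \<theta> * ?E \<theta>)"
  have E: "0 < ?E \<theta>" for \<theta>
    by (rule LBINT_normal_inverse_mills_pos[OF assms(1)])
  have "?A \<theta> \<le> 0" for \<theta>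
  proof (rule normal_covariance_antimono_nonpos[OF assms(1)])
    show "linear_growth (\<lambda>x. inverse_mills (c * x / \<sigma>))"
      using linear_growth_inverse_mills[of "c / \<sigma>"] by simp
    show "antimono (\<lambda>x. inverse_mills (c * x / \<sigma>))"
      using assms by (intro antimonoI inverse_mills_antimono divide_right_mono mult_left_mono) auto
  qed
  moreover have "0 \<le> 1 - c\<^sup>2"
    using assms by (simp add: power_le_one)
  ultimately have A: "(1 - c\<^sup>2) * ?A \<theta> \<le> 0" for \<theta>
    by (simp add: mult_nonneg_nonpos)
  have le: "?d \<theta> \<le> 0" if "0 \<le> \<theta>" for \<theta>
  proof -
    have "0 \<le> c\<^sup>2 * \<theta> * ?E \<theta>"
      using that E[of \<theta>] by simp
    with A[of \<theta>] show ?thesis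
      using assms by (intro mult_nonneg_nonpos) auto
  qed
  have less: "?d 1 < 0"
  proof -
    have "0 < c\<^sup>2 * 1 * ?E 1"
      using E[of 1] assms by simp
    with A[of 1] show ?thesis
      using assms by (intro mult_pos_neg) auto
  qed
  show ?thesis
    unfolding dominates_def risk_ident[OF assms(1)] risk_delta_est[OF assms(1,2)]
  proof (intro conjI ballI bexI[of _ 1] estimator_delta_est)
    show "estimator (\<lambda>x. x)" by (simp add: estimator_def)
  next
    fix \<theta> :: real assume "\<theta> \<in> {0..}"
    then show "ennreal (\<sigma>\<^sup>2 + ?d \<theta>) \<le> ennreal (\<sigma>\<^sup>2)"
      using le[of \<theta>] by (intro ennreal_leI) simp
  next
    show "ennreal (\<sigma>\<^sup>2 + ?d 1) < ennreal (\<sigma>\<^sup>2)"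
      using less assms by (intro ennreal_lessI) auto
  qed simp
qed

section \<open>No estimator has risk below the variance on a half line\<close>

text \<open>Completing the square. Dividing by \<open>normal_density \<theta> \<sigma> x\<close> and integrating, it computes the
  second moment \<open>exp (h\<^sup>2 / \<sigma>\<^sup>2)\<close> of the likelihood ratio of \<open>\<theta> + h\<close> against \<open>\<theta>\<close>.\<close>
lemma normal_density_shift_square:
  assumes "\<sigma> > 0"
  shows "(normal_density (\<theta> + h) \<sigma> x)\<^sup>2
    = exp (h\<^sup>2 / \<sigma>\<^sup>2) * (normal_density (\<theta> + 2 * h) \<sigma> x * normal_density \<theta> \<sigma> x)"
proof -
  have "- (x - (\<theta> + h))\<^sup>2 / (2 * \<sigma>\<^sup>2) + - (x - (\<theta> + h))\<^sup>2 / (2 * \<sigma>\<^sup>2)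
     = h\<^sup>2 / \<sigma>\<^sup>2 + (- (x - (\<theta> + 2 * h))\<^sup>2 / (2 * \<sigma>\<^sup>2) + - (x - \<theta>)\<^sup>2 / (2 * \<sigma>\<^sup>2))"
    using assms by (simp add: field_simps power2_eq_square)
  then have "exp (- (x - (\<theta> + h))\<^sup>2 / (2 * \<sigma>\<^sup>2)) * exp (- (x - (\<theta> + h))\<^sup>2 / (2 * \<sigma>\<^sup>2))
     = exp (h\<^sup>2 / \<sigma>\<^sup>2) * (exp (- (x - (\<theta> + 2 * h))\<^sup>2 / (2 * \<sigma>\<^sup>2)) * exp (- (x - \<theta>)\<^sup>2 / (2 * \<sigma>\<^sup>2)))"
    by (simp only: exp_add[symmetric])
  moreover define K where "K = 1 / sqrt (2 * pi * \<sigma>\<^sup>2)"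
  ultimately show ?thesis
    unfolding normal_density_def K_def[symmetric] power2_eq_square[of "K * _"] by algebra
qed

lemma risk_le_ennrealD:
  assumes "\<sigma> > 0" "estimator \<delta>" "0 \<le> r" "risk \<sigma> \<theta> \<delta> \<le> ennreal r"
  shows "integrable lborel (\<lambda>x. normal_density \<theta> \<sigma> x * (\<delta> x - \<theta>)\<^sup>2)"
    and "(LBINT x. normal_density \<theta> \<sigma> x * (\<delta> x - \<theta>)\<^sup>2) \<le> r"
proof -
  have [measurable]: "\<delta> \<in> borel_measurable borel"
    using assms(2) by (simp add: estimator_def)
  have "(\<integral>\<^sup>+ x. ennreal (normal_density \<theta> \<sigma> x * (\<delta> x - \<theta>)\<^sup>2) \<partial>lborel) < \<infinity>"
    using assms(4) unfolding risk_eq_nn_integral[OF assms(1,2)] by (auto intro: le_less_trans)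
  then show int: "integrable lborel (\<lambda>x. normal_density \<theta> \<sigma> x * (\<delta> x - \<theta>)\<^sup>2)"
    by (intro integrableI_nonneg) auto
  show "(LBINT x. normal_density \<theta> \<sigma> x * (\<delta> x - \<theta>)\<^sup>2) \<le> r"
    using assms(3,4) unfolding risk_eq_LBINT[OF assms(1,2) int] by (simp add: ennreal_le_iff)
qed

lemma abs_le_one_plus_square: "\<bar>y\<bar> \<le> 1 + y\<^sup>2" for y :: real
proof -
  have "2 * \<bar>y\<bar> \<le> 1 + y\<^sup>2"
    using sum_squares_bound[of 1 "\<bar>y\<bar>"] by simp
  then show ?thesis by linarith
qed

lemma integrable_estimator_of_risk:
  assumes "\<sigma> > 0" "estimator \<delta>" "integrable lborel (\<lambda>x. normal_density \<theta> \<sigma> x * (\<delta> x - \<theta>)\<^sup>2)"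
  shows "integrable lborel (\<lambda>x. normal_density \<theta> \<sigma> x * (\<delta> x - \<theta>))"
proof (rule Bochner_Integration.integrable_bound)
  have [measurable]: "\<delta> \<in> borel_measurable borel"
    using assms(2) by (simp add: estimator_def)
  show "integrable lborel (\<lambda>x. normal_density \<theta> \<sigma> x + normal_density \<theta> \<sigma> x * (\<delta> x - \<theta>)\<^sup>2)"
    using assms by (intro Bochner_Integration.integrable_add) auto
  show "(\<lambda>x. normal_density \<theta> \<sigma> x * (\<delta> x - \<theta>)) \<in> borel_measurable lborel"
    by measurable
  show "AE x in lborel. norm (normal_density \<theta> \<sigma> x * (\<delta> x - \<theta>))
     \<le> norm (normal_density \<theta> \<sigma> x + normal_density \<theta> \<sigma> x * (\<delta> x - \<theta>)\<^sup>2)"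
  proof (rule AE_I2)
    fix x
    have "\<bar>\<delta> x - \<theta>\<bar> \<le> 1 + (\<delta> x - \<theta>)\<^sup>2"
      by (rule abs_le_one_plus_square)
    then have "normal_density \<theta> \<sigma> x * \<bar>\<delta> x - \<theta>\<bar> \<le> normal_density \<theta> \<sigma> x * (1 + (\<delta> x - \<theta>)\<^sup>2)"
      by (intro mult_left_mono) auto
    then show "norm (normal_density \<theta> \<sigma> x * (\<delta> x - \<theta>))
       \<le> norm (normal_density \<theta> \<sigma> x + normal_density \<theta> \<sigma> x * (\<delta> x - \<theta>)\<^sup>2)"
      by (simp add: abs_mult distrib_left)
  qed
qed

definition bias :: "real \<Rightarrow> (real \<Rightarrow> real) \<Rightarrow> real \<Rightarrow> real" where
  "bias \<sigma> \<delta> \<theta> = (LBINT x. normal_density \<theta> \<sigma> x * (\<delta> x - \<theta>))"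

lemma abs_bias_le:
  assumes "\<sigma> > 0" "estimator \<delta>" "0 \<le> r" "risk \<sigma> \<theta> \<delta> \<le> ennreal r"
  shows "\<bar>bias \<sigma> \<delta> \<theta>\<bar> \<le> 1 + r"
proof -
  let ?p = "normal_density \<theta> \<sigma>"
  note int2 = risk_le_ennrealD(1)[OF assms]
  note int1 = integrable_estimator_of_risk[OF assms(1,2) int2]
  have "\<bar>bias \<sigma> \<delta> \<theta>\<bar> \<le> (LBINT x. \<bar>?p x * (\<delta> x - \<theta>)\<bar>)"
    unfolding bias_def by (rule integral_abs_bound)
  also have "\<dots> \<le> (LBINT x. ?p x + ?p x * (\<delta> x - \<theta>)\<^sup>2)"
  proof (intro integral_mono integrable_abs int1 Bochner_Integration.integrable_add int2)
    show "integrable lborel ?p" using assms(1) by simp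
    fix x
    have "\<bar>\<delta> x - \<theta>\<bar> \<le> 1 + (\<delta> x - \<theta>)\<^sup>2"
      by (rule abs_le_one_plus_square)
    then have "?p x * \<bar>\<delta> x - \<theta>\<bar> \<le> ?p x * (1 + (\<delta> x - \<theta>)\<^sup>2)"
      by (intro mult_left_mono) auto
    then show "\<bar>?p x * (\<delta> x - \<theta>)\<bar> \<le> ?p x + ?p x * (\<delta> x - \<theta>)\<^sup>2"
      by (simp add: abs_mult distrib_left)
  qed
  also have "\<dots> \<le> 1 + r"
    using assms(1) int2 risk_le_ennrealD(2)[OF assms] by simp
  finally show ?thesis .
qed

text \<open>Let \<open>L\<close> be the likelihood ratio of \<open>\<theta> + h\<close> against \<open>\<theta>\<close>, minus one. Then
  \<open>E[(\<delta> - \<theta>) L]\<close> is the increase of the mean of \<open>\<delta>\<close> from \<open>\<theta>\<close> to \<open>\<theta> + h\<close>, and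
  \<open>E[L\<^sup>2] = exp (h\<^sup>2 / \<sigma>\<^sup>2) - 1\<close>. The inequality expands \<open>0 \<le> E[(\<delta> - \<theta> - k L)\<^sup>2]\<close>. Keeping
  \<open>k\<close> free instead of optimising over it leaves a bound linear in the increment of the mean, so
  that it can be summed over steps.\<close>
lemma chapman_robbins:
  assumes "\<sigma> > 0" "estimator \<delta>" "0 \<le> r"
    and "risk \<sigma> \<theta> \<delta> \<le> ennreal r" "risk \<sigma> (\<theta> + h) \<delta> \<le> ennreal r"
  shows "2 * k * (bias \<sigma> \<delta> (\<theta> + h) + h - bias \<sigma> \<delta> \<theta>) \<le> r + k\<^sup>2 * (exp (h\<^sup>2 / \<sigma>\<^sup>2) - 1)"
proof -
  let ?p = "normal_density \<theta> \<sigma>" and ?q = "normal_density (\<theta> + h) \<sigma>"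
    and ?s = "normal_density (\<theta> + 2 * h) \<sigma>"
  define e where "e = exp (h\<^sup>2 / \<sigma>\<^sup>2)"
  note int2 = risk_le_ennrealD(1)[OF assms(1-4)]
  note intp = integrable_estimator_of_risk[OF assms(1,2) int2]
  note intq = integrable_estimator_of_risk[OF assms(1,2) risk_le_ennrealD(1)[OF assms(1-3,5)]]
  \<comment> \<open>the integrand \<open>p (\<delta> - \<theta> - k L)\<^sup>2\<close> with \<open>p L = q - p\<close> and \<open>p L\<^sup>2 = e s - 2 q + p\<close>, free of quotients\<close>
  define I where "I x = ?p x * (\<delta> x - \<theta>)\<^sup>2
      - 2 * k * (?q x * (\<delta> x - (\<theta> + h)) + h * ?q x - ?p x * (\<delta> x - \<theta>))
      + k\<^sup>2 * (e * ?s x - 2 * ?q x + ?p x)" for x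
  have "0 \<le> I x" for x
  proof -
    have p: "0 < ?p x" using assms(1) by (rule normal_density_pos)
    have "?p x * I x = (?p x * (\<delta> x - \<theta>) - k * (?q x - ?p x))\<^sup>2"
      using normal_density_shift_square[OF assms(1), of \<theta> h x]
      unfolding I_def e_def[symmetric] by algebra
    then have "0 \<le> ?p x * I x" by simp
    with p show ?thesis by (simp add: zero_le_mult_iff)
  qed
  then have "0 \<le> (LBINT x. I x)"
    by (intro Bochner_Integration.integral_nonneg) auto
  also have "(LBINT x. I x) = (LBINT x. ?p x * (\<delta> x - \<theta>)\<^sup>2)
      - 2 * k * (bias \<sigma> \<delta> (\<theta> + h) + h - bias \<sigma> \<delta> \<theta>) + k\<^sup>2 * (e - 1)"
    unfolding I_def bias_def using int2 intp intq assms(1) by simp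
  also have "(LBINT x. ?p x * (\<delta> x - \<theta>)\<^sup>2) \<le> r"
    by (rule risk_le_ennrealD(2)[OF assms(1-4)])
  finally show ?thesis by (simp add: e_def)
qed

text \<open>The sum of the Chapman-Robbins bounds over the steps \<open>0, h, \<dots>, n h\<close> telescopes; the bias at the two
  ends is bounded independently of \<open>n\<close> and disappears after division by \<open>n\<close>. This is where
  the parameter space has to be unbounded.\<close>
lemma uniform_risk_bound_ge:
  assumes "\<sigma> > 0" "estimator \<delta>" "0 \<le> r"
    and risk: "\<And>\<theta>. 0 \<le> \<theta> \<Longrightarrow> risk \<sigma> \<theta> \<delta> \<le> ennreal r"
  shows "\<sigma>\<^sup>2 \<le> r"
proof -
  have bound: "2 * k * h \<le> r + k\<^sup>2 * (exp (h\<^sup>2 / \<sigma>\<^sup>2) - 1)" if h: "0 < h" and k: "0 < k" for h k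
  proof -
    define v where "v = r + k\<^sup>2 * (exp (h\<^sup>2 / \<sigma>\<^sup>2) - 1)"
    have "2 * k * (bias \<sigma> \<delta> (real n * h) + real n * h - bias \<sigma> \<delta> 0) \<le> real n * v" for n
    proof (induction n)
      case (Suc n)
      have "2 * k * (bias \<sigma> \<delta> (real n * h + h) + h - bias \<sigma> \<delta> (real n * h)) \<le> v"
        unfolding v_def using h by (intro chapman_robbins assms risk) auto
      moreover have "real n * h + h = real (Suc n) * h"
        by (simp add: algebra_simps)
      ultimately show ?case
        using Suc.IH by (simp add: algebra_simps)
    qed simp
    moreover have "real n * h - 2 * (1 + r) \<le> bias \<sigma> \<delta> (real n * h) + real n * h - bias \<sigma> \<delta> 0" for n
    proof -
      have "\<bar>bias \<sigma> \<delta> (real n * h)\<bar> \<le> 1 + r" "\<bar>bias \<sigma> \<delta> 0\<bar> \<le> 1 + r"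
        using h by (auto intro!: abs_bias_le assms risk)
      then show ?thesis by (simp only: abs_le_iff) argo
    qed
    ultimately have *: "2 * k * (real n * h - 2 * (1 + r)) \<le> real n * v" for n
      using k by (meson mult_left_mono order_trans less_imp_le mult_pos_pos zero_less_numeral)
    have "2 * k * h - v \<le> 0"
    proof (rule ccontr)
      assume "\<not> ?thesis"
      then obtain n where "4 * k * (1 + r) < real n * (2 * k * h - v)"
        using reals_Archimedean3 by (metis not_le)
      with *[of n] show False by (simp add: algebra_simps)
    qed
    then show ?thesis by (simp add: v_def)
  qed
  \<comment> \<open>As \<open>h \<rightarrow> 0\<close> the optimal \<open>k = h / (exp (h\<^sup>2 / \<sigma>\<^sup>2) - 1)\<close> behaves like \<open>\<sigma>\<^sup>2 / h\<close>.\<close>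
  have "2 * \<sigma>\<^sup>2 - \<sigma>^4 * ((exp (h\<^sup>2 / \<sigma>\<^sup>2) - 1) / h\<^sup>2) \<le> r" if "0 < h" for h
  proof -
    have "2 * (\<sigma>\<^sup>2 / h) * h \<le> r + (\<sigma>\<^sup>2 / h)\<^sup>2 * (exp (h\<^sup>2 / \<sigma>\<^sup>2) - 1)"
      using that assms(1) by (intro bound) auto
    moreover have "(\<sigma>\<^sup>2 / h)\<^sup>2 * (exp (h\<^sup>2 / \<sigma>\<^sup>2) - 1) = \<sigma>^4 * ((exp (h\<^sup>2 / \<sigma>\<^sup>2) - 1) / h\<^sup>2)"
      by (simp add: power_divide)
    ultimately show ?thesis using that by simp
  qed
  then have "eventually (\<lambda>h. 2 * \<sigma>\<^sup>2 - \<sigma>^4 * ((exp (h\<^sup>2 / \<sigma>\<^sup>2) - 1) / h\<^sup>2) \<le> r) (at_right 0)"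
    by (auto simp: eventually_at_filter)
  moreover have "((\<lambda>h. 2 * \<sigma>\<^sup>2 - \<sigma>^4 * ((exp (h\<^sup>2 / \<sigma>\<^sup>2) - 1) / h\<^sup>2)) \<longlongrightarrow> 2 * \<sigma>\<^sup>2 - \<sigma>^4 * inverse (\<sigma>\<^sup>2)) (at_right 0)"
    using assms(1) by real_asymp
  ultimately have "2 * \<sigma>\<^sup>2 - \<sigma>^4 * inverse (\<sigma>\<^sup>2) \<le> r"
    by (intro tendsto_upperbound[of _ _ "at_right 0"]) auto
  moreover have "\<sigma>^4 * inverse (\<sigma>\<^sup>2) = \<sigma>\<^sup>2"
    using assms(1) by (simp add: field_simps flip: power_add)
  ultimately show ?thesis by linarith
qed

lemma SUP_risk_ge:
  assumes "\<sigma> > 0" "estimator \<delta>"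
  shows "ennreal (\<sigma>\<^sup>2) \<le> (SUP \<theta>\<in>{0..}. risk \<sigma> \<theta> \<delta>)"
proof (cases "SUP \<theta>\<in>{0..}. risk \<sigma> \<theta> \<delta>")
  case (real r)
  then have "risk \<sigma> \<theta> \<delta> \<le> ennreal r" if "0 \<le> \<theta>" for \<theta>
    using that by (metis SUP_upper atLeast_iff)
  then have "\<sigma>\<^sup>2 \<le> r"
    using real(1) by (intro uniform_risk_bound_ge[OF assms]) auto
  then show ?thesis
    unfolding real(2) by (rule ennreal_leI)
next
  case top
  show ?thesis unfolding top by simp
qed

text \<open>The estimator \<open>X\<close> has constant risk \<open>\<sigma>\<^sup>2\<close>, the lower bound just found for every maximal
  risk; an estimator that is nowhere worse attains it as well.\<close>
lemma minimax_of_dominates_ident: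
  assumes "\<sigma> > 0" "dominates \<sigma> {0..} \<delta> (\<lambda>x. x)"
  shows "minimax \<sigma> {0..} \<delta>"
  unfolding minimax_def
proof (intro conjI antisym)
  show est: "estimator \<delta>" using assms(2) by (simp add: dominates_def)
  have "(SUP \<theta>\<in>{0..}. risk \<sigma> \<theta> \<delta>) \<le> ennreal (\<sigma>\<^sup>2)"
    using assms(2) by (auto intro!: SUP_least simp: dominates_def risk_ident[OF assms(1)])
  also have "\<dots> \<le> (INF \<delta>'\<in>Collect estimator. SUP \<theta>\<in>{0..}. risk \<sigma> \<theta> \<delta>')"
    by (auto intro!: INF_greatest SUP_risk_ge assms(1))
  finally show "(SUP \<theta>\<in>{0..}. risk \<sigma> \<theta> \<delta>) \<le> (INF \<delta>'\<in>Collect estimator. SUP \<theta>\<in>{0..}. risk \<sigma> \<theta> \<delta>')" .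
  show "(INF \<delta>'\<in>Collect estimator. SUP \<theta>\<in>{0..}. risk \<sigma> \<theta> \<delta>') \<le> (SUP \<theta>\<in>{0..}. risk \<sigma> \<theta> \<delta>)"
    using est by (intro INF_lower) simp
qed

theorem theorem3:
  fixes \<sigma> c :: real
  assumes "\<sigma> > 0" and "0 < c" and "c \<le> 1"
  shows "dominates \<sigma> {0..} (delta_est \<sigma> c) (\<lambda>x. x) \<and> minimax \<sigma> {0..} (delta_est \<sigma> c)"
  using delta_est_dominates_ident[OF assms] minimax_of_dominates_ident[OF assms(1)] by blast

end
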